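(* Let $c \in \mathbb{Q}$ and let $\varphi_c \colon \mathbb{Q} \to \mathbb{Q}$ be defined by $\varphi_c(x) = x^2 - c$. If $\varphi_c$ admits a rational cycle of length $n \ge 3$, then $\operatorname{den}(c)$ is divisible by $16$.
   Context: For $z \in \mathbb{Q}$, $\operatorname{num}(z)$ and $\operatorname{den}(z)$ are the unique coprime integers with $\operatorname{den}(z) \ge 1$ and $z = \operatorname{num}(z)/\operatorname{den}(z)$. A point $z$ is periodic under a self map $\varphi$ if $\varphi^n(z) = z$ for some integer $n \ge 1$ (where $\varphi^n$ is the $n$-th iterate); the least such $n$ is its period. A (rational) cycle of length $n$ of $\varphi_c$ is the finite sequence $(z, \varphi_c(z), \dots, \varphi_c^{n-1}(z))$ where $z \in \mathbb{Q}$ is periodic of period exactly $n$. *)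

theory Defs
  imports Complex_Main "HOL-Combinatorics.Cycles"
begin

text \<open>
  \<^const>\<open>quotient_of\<close> returns the unique coprime pair of integers
  with positive second component representing a rational number.
\<close>

definition den :: "rat \<Rightarrow> int" where
  "den z = snd (quotient_of z)"

definition phi :: "rat \<Rightarrow> rat \<Rightarrow> rat" where
  "phi c x = x\<^sup>2 - c"

definition periodic :: "('a \<Rightarrow> 'a) \<Rightarrow> 'a \<Rightarrow> bool" where
  "periodic f z \<longleftrightarrow> (\<exists>n\<ge>1. (f ^^ n) z = z)"

text \<open>
  For \<open>z\<close> periodic under \<open>f\<close>, its period is \<^term>\<open>least_power f z\<close>, the least
  \<open>n > 0\<close> with \<open>(f ^^ n) z = z\<close>. For other \<open>z\<close> that value is meaningless, so
  periodicity is required separately.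
\<close>

definition is_cycle :: "('a \<Rightarrow> 'a) \<Rightarrow> nat \<Rightarrow> 'a list \<Rightarrow> bool" where
  "is_cycle f n zs \<longleftrightarrow>
     (\<exists>z. periodic f z \<and> least_power f z = n \<and> zs = map (\<lambda>i. (f ^^ i) z) [0..<n])"

end

theory Submission
  imports Defs "HOL-Computational_Algebra.Euclidean_Algorithm"
begin

text \<open>
  The proof is 2-adic. Write \<open>x\<^sub>0, x\<^sub>1, \<dots>\<close> for the orbit of a point of exact period \<open>n \<ge> 3\<close>, and
  suppose that \<open>16\<close> does not divide the denominator of \<open>c\<close>.

  A point whose 2-adic valuation is below \<open>-1\<close> would have a square of valuation below that of \<open>c\<close>,
  so the valuations would strictly decrease along the cycle. Hence every \<open>2 x\<^sub>i\<close> is 2-integral. Since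
  \<open>(2 x\<^sub>i)\<^sup>2 = 4 c + 4 x\<^sub>i\<^sub>+\<^sub>1\<close>, all \<open>2 x\<^sub>i\<close> have the parity of \<open>4 c\<close>, so all sums \<open>x\<^sub>i + x\<^sub>j\<close> are 2-integral.

  The identity \<open>x\<^sub>i\<^sub>+\<^sub>1 - x\<^sub>j\<^sub>+\<^sub>1 = (x\<^sub>i - x\<^sub>j)(x\<^sub>i + x\<^sub>j)\<close>, multiplied around the cycle, shows that the product
  of the \<open>x\<^sub>i + x\<^sub>i\<^sub>+\<^sub>m\<close> over a period is \<open>1\<close> for \<open>0 < m < n\<close>. So \<open>x\<^sub>i + x\<^sub>j\<close> is odd (a 2-adic unit)
  whenever \<open>x\<^sub>i \<noteq> x\<^sub>j\<close>. Consequently each difference \<open>x\<^sub>i\<^sub>+\<^sub>s - x\<^sub>i\<close> with \<open>0 < s < n\<close> is an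
  odd multiple of \<open>x\<^sub>s - x\<^sub>0\<close>.

  If \<open>n = s m\<close> with \<open>m \<ge> 3\<close> odd, then the \<open>m\<close> differences \<open>x\<^bsub>s(j+1)\<^esub> - x\<^bsub>sj\<^esub>\<close> telescope to \<open>0\<close>, although their sum
  is an odd multiple of a nonzero number (lemma \<open>no_odd_factor\<close>).

  If \<open>n\<close> has no odd factor \<open>\<ge> 3\<close>, then \<open>n = 2 m\<close> with \<open>m\<close> even. Half a turn around the cycle negates
  \<open>x\<^sub>m - x\<^sub>0\<close>, so the product of the \<open>m\<close> numbers \<open>s\<^sub>i = x\<^sub>i + x\<^sub>i\<^sub>+\<^sub>m\<close> is \<open>-1\<close>. The \<open>s\<^sub>i\<close> are odd, and they are
  congruent modulo \<open>4\<close>: as there are at least three points, \<open>2 x\<^sub>i\<close> is odd, so \<open>d = x\<^sub>i\<^sub>+\<^sub>1 - x\<^sub>i\<close> is even,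
  and \<open>s\<^sub>i\<^sub>+\<^sub>1 - s\<^sub>i\<close> is the sum of \<open>d\<close> and an odd multiple of \<open>d\<close>. But an even number of congruent odd
  factors has product \<open>1\<close> modulo \<open>4\<close> (lemma \<open>no_double_even_length\<close>).
\<close>

section \<open>2-integral rational numbers\<close>

definition two_integral :: "rat set" where
  "two_integral = {r. \<exists>b::int. odd b \<and> of_int b * r \<in> \<int>}"

text \<open>
  Congruences modulo \<open>2^k\<close> between 2-integral numbers are expressed by saying that
  their difference, divided by \<open>2^k\<close>, is again 2-integral; this is congruence to \<open>1\<close> modulo \<open>2\<close>.
\<close>

definition two_odd :: "rat \<Rightarrow> bool" where
  "two_odd r \<longleftrightarrow> (r - 1) / 2 \<in> two_integral"

lemma two_integralI: "odd b \<Longrightarrow> of_int b * r = of_int a \<Longrightarrow> r \<in> two_integral"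
  unfolding two_integral_def by (auto intro!: exI[of _ b])

lemma two_integralE:
  assumes "r \<in> two_integral"
  obtains a b :: int where "odd b" "of_int b * r = of_int a"
  using assms unfolding two_integral_def by (auto elim!: Ints_cases)

lemma two_integral_of_int [simp]: "of_int a \<in> two_integral"
  by (rule two_integralI[of 1]) auto

lemma two_integral_numeral [simp]:
  "0 \<in> two_integral" "1 \<in> two_integral" "numeral k \<in> two_integral"
  using two_integral_of_int[of 0] two_integral_of_int[of 1] two_integral_of_int[of "numeral k"]
  by simp_all

lemma two_integral_mult:
  assumes "r \<in> two_integral" "s \<in> two_integral"
  shows "r * s \<in> two_integral"
proof -
  obtain a b where 1: "odd b" "of_int b * r = of_int a" using assms(1) by (rule two_integralE)
  obtain a' b' where 2: "odd b'" "of_int b' * s = of_int a'" using assms(2) by (rule two_integralE)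
  have "of_int (b * b') * (r * s) = (of_int b * r) * (of_int b' * s)" by simp
  also have "\<dots> = of_int (a * a')" using 1 2 by simp
  finally show ?thesis using 1 2 by (intro two_integralI[of "b * b'" _ "a * a'"]) auto
qed

lemma two_integral_add:
  assumes "r \<in> two_integral" "s \<in> two_integral"
  shows "r + s \<in> two_integral"
proof -
  obtain a b where 1: "odd b" "of_int b * r = of_int a" using assms(1) by (rule two_integralE)
  obtain a' b' where 2: "odd b'" "of_int b' * s = of_int a'" using assms(2) by (rule two_integralE)
  have "of_int (b * b') * (r + s) = of_int b' * (of_int b * r) + of_int b * (of_int b' * s)"
    by (simp add: algebra_simps)
  also have "\<dots> = of_int (b' * a + b * a')" using 1 2 by simp
  finally show ?thesis using 1 2 by (intro two_integralI[of "b * b'" _ "b' * a + b * a'"]) auto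
qed

lemma two_integral_minus: "r \<in> two_integral \<Longrightarrow> - r \<in> two_integral"
  using two_integral_mult[OF two_integral_of_int[of "- 1"], of r] by simp

lemma two_integral_diff:
  "r \<in> two_integral \<Longrightarrow> s \<in> two_integral \<Longrightarrow> r - s \<in> two_integral"
  using two_integral_add[of r "- s"] two_integral_minus[of s] by simp

lemma two_integral_prod:
  "(\<And>i. i \<in> A \<Longrightarrow> f i \<in> two_integral) \<Longrightarrow> prod f A \<in> two_integral"
  by (induction A rule: infinite_finite_induct) (auto intro: two_integral_mult)

lemma two_integral_power: "r \<in> two_integral \<Longrightarrow> r ^ k \<in> two_integral"
  by (induction k) (auto intro: two_integral_mult)

lemma half_not_two_integral: "(1 / 2 :: rat) \<notin> two_integral"
proof
  assume "(1 / 2 :: rat) \<in> two_integral"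
  then obtain a b :: int where b: "odd b" "of_int b * (1 / 2 :: rat) = of_int a"
    by (rule two_integralE)
  then have "(of_int b :: rat) = of_int (2 * a)" by simp
  then have "b = 2 * a" by (simp only: of_int_eq_iff)
  with b show False by simp
qed

lemma two_integral_even_or_odd:
  assumes "r \<in> two_integral"
  shows "r / 2 \<in> two_integral \<or> two_odd r"
proof -
  obtain a b where b: "odd b" "of_int b * r = of_int a" using assms by (rule two_integralE)
  show ?thesis
  proof (cases "even a")
    case True
    then obtain k where k: "a = 2 * k" by (elim evenE)
    have "of_int b * (r / 2) = of_int k" using b k by simp
    then show ?thesis using b two_integralI by blast
  next
    case False
    with b have "even (a - b)" by simp
    then obtain k where "a - b = 2 * k" by (elim evenE)
    then have "(of_int a - of_int b :: rat) = of_int (2 * k)" by (metis of_int_diff)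
    then have "of_int b * ((r - 1) / 2) = of_int k" using b by (simp add: algebra_simps)
    then show ?thesis using b two_integralI unfolding two_odd_def by blast
  qed
qed

text \<open>The factor \<open>2\<close> costs nothing because the valuation of a square is even.\<close>

lemma two_integral_if_double_square:
  assumes "2 * y\<^sup>2 \<in> two_integral"
  shows "y \<in> two_integral"
proof -
  obtain a b :: int where q: "quotient_of y = (a, b)" by (cases "quotient_of y")
  have y: "y = of_int a / of_int b" and b0: "b > 0" and cop: "coprime a b"
    using q quotient_of_div quotient_of_denom_pos quotient_of_coprime by blast+
  obtain p r :: int where r: "odd r" "of_int r * (2 * y\<^sup>2) = of_int p"
    using assms by (rule two_integralE)
  have "of_int (2 * r * a\<^sup>2) = (of_int (p * b\<^sup>2) :: rat)"
    using r b0 unfolding y by (simp add: field_simps)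
  then have eq: "2 * r * a\<^sup>2 = p * b\<^sup>2" by (simp only: of_int_eq_iff)
  have "odd b"
  proof
    assume "even b"
    then have "odd a" using cop by (metis coprime_common_divisor odd_one)
    obtain k where k: "b = 2 * k" using \<open>even b\<close> by (elim evenE)
    have "r * a\<^sup>2 = 2 * (p * k\<^sup>2)" using eq unfolding k by (simp add: power_mult_distrib)
    then have "even (r * a\<^sup>2)" by simp
    with \<open>odd a\<close> \<open>odd r\<close> show False by simp
  qed
  then show ?thesis using b0 unfolding y by (intro two_integralI[of b _ a]) auto
qed

lemma ex_two_odd_part:
  fixes q :: int
  assumes "q \<noteq> 0"
  obtains k o' where "q = 2 ^ k * o'" "odd o'"
proof (rule multiplicity_decompose'[of q 2])
  show "q \<noteq> 0" by fact
  show "\<not> is_unit (2::int)" by simp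
qed (rule that)

lemma ex_power_two_mult_two_integral: "\<exists>k. 2 ^ k * r \<in> two_integral"
proof -
  obtain a b :: int where q: "quotient_of r = (a, b)" by (cases "quotient_of r")
  have r: "r = of_int a / of_int b" and b0: "b > 0"
    using q quotient_of_div quotient_of_denom_pos by blast+
  obtain k o' where k: "b = 2 ^ k * o'" "odd o'" using ex_two_odd_part[of b] b0 by auto
  have "of_int o' * (2 ^ k * r) = of_int a" using b0 unfolding r k by auto
  then show ?thesis using k two_integralI by blast
qed

lemma eight_mult_two_integral:
  assumes "\<not> 16 dvd den c"
  shows "8 * c \<in> two_integral"
proof -
  obtain a b :: int where q: "quotient_of c = (a, b)" by (cases "quotient_of c")
  have c: "c = of_int a / of_int b" and b0: "b > 0" and b16: "\<not> 16 dvd b"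
    using q quotient_of_div quotient_of_denom_pos assms unfolding den_def by auto
  obtain k o' where k: "b = 2 ^ k * o'" "odd o'" using ex_two_odd_part[of b] b0 by auto
  have "k \<le> 3"
  proof (rule ccontr)
    assume "\<not> k \<le> 3"
    then have "(2::int) ^ 4 dvd 2 ^ k" by (intro le_imp_power_dvd) auto
    with b16 show False unfolding k by simp
  qed
  then have "(8::rat) = 2 ^ (3 - k) * 2 ^ k" by (simp flip: power_add)
  then have "of_int o' * (8 * c) = of_int (2 ^ (3 - k) * a)"
    using b0 unfolding c k by (auto simp: field_simps)
  then show ?thesis using k two_integralI by blast
qed

lemma two_odd_one [simp]: "two_odd 1"
  by (simp add: two_odd_def)

lemma two_odd_imp_two_integral:
  assumes "two_odd r"
  shows "r \<in> two_integral"
proof -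
  have "2 * ((r - 1) / 2) + 1 \<in> two_integral"
    using assms unfolding two_odd_def by (intro two_integral_add two_integral_mult) auto
  then show ?thesis by (simp only: nonzero_mult_div_cancel_left times_divide_eq_right) simp
qed

lemma two_odd_add_even:
  assumes "two_odd r" "s / 2 \<in> two_integral"
  shows "two_odd (r + s)"
  using two_integral_add[OF assms(1)[unfolded two_odd_def] assms(2)]
  by (simp add: two_odd_def field_simps)

lemma two_odd_add:
  assumes "two_odd r" "two_odd s"
  shows "(r + s) / 2 \<in> two_integral"
proof -
  have "(r - 1) / 2 + (s - 1) / 2 + 1 \<in> two_integral"
    using assms unfolding two_odd_def by (intro two_integral_add) auto
  moreover have "(r - 1) / 2 + (s - 1) / 2 + 1 = (r + s) / 2" by (simp add: field_simps)
  ultimately show ?thesis by simp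
qed

lemma two_odd_diff:
  assumes "two_odd r" "two_odd s"
  shows "(r - s) / 2 \<in> two_integral"
  using two_integral_diff[OF assms[unfolded two_odd_def]]
  by (simp flip: diff_divide_distrib)

lemma two_odd_not_even: "two_odd r \<Longrightarrow> r / 2 \<notin> two_integral"
  using two_integral_diff[of "r / 2" "(r - 1) / 2"] half_not_two_integral
  by (auto simp: two_odd_def diff_divide_distrib)

lemma two_odd_mult:
  assumes "two_odd r" "two_odd s"
  shows "two_odd (r * s)"
proof -
  have "(r - 1) / 2 * s + (s - 1) / 2 \<in> two_integral"
    using assms two_odd_imp_two_integral unfolding two_odd_def
    by (intro two_integral_add two_integral_mult) auto
  also have "(r - 1) / 2 * s + (s - 1) / 2 = (r * s - 1) / 2" by (simp add: field_simps)
  finally show ?thesis by (simp only: two_odd_def)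
qed

lemma two_odd_prod: "(\<And>i. i \<in> A \<Longrightarrow> two_odd (f i)) \<Longrightarrow> two_odd (prod f A)"
  by (induction A rule: infinite_finite_induct) (auto intro: two_odd_mult)

lemma two_odd_sum_odd_number:
  fixes k :: nat
  assumes "\<And>i. two_odd (f i)"
  shows "two_odd (\<Sum>i<2 * k + 1. f i)"
proof (induction k)
  case 0
  then show ?case using assms by simp
next
  case (Suc k)
  have "two_odd ((\<Sum>i<2 * k + 1. f i) + (f (2 * k + 1) + f (2 * k + 2)))"
    using Suc assms by (intro two_odd_add_even two_odd_add)
  then show ?case by (simp add: algebra_simps)
qed

lemma two_odd_square_cong_one:
  assumes "two_odd r"
  shows "(r\<^sup>2 - 1) / 4 \<in> two_integral"
proof -
  have "(r - 1) / 2 * ((r - 1) / 2 + 1) \<in> two_integral"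
    using assms unfolding two_odd_def by (intro two_integral_mult two_integral_add) auto
  then show ?thesis by (simp add: field_simps power2_eq_square)
qed

text \<open>Factors congruent modulo \<open>4\<close> pair up to squares, which are \<open>1\<close> modulo \<open>4\<close>.\<close>

lemma prod_even_number_cong_one:
  fixes k :: nat
  assumes odd: "\<And>i. two_odd (f i)"
    and cong: "\<And>i. (f (Suc i) - f i) / 4 \<in> two_integral"
  shows "((\<Prod>i<2 * k. f i) - 1) / 4 \<in> two_integral"
proof (induction k)
  case 0
  then show ?case by simp
next
  case (Suc k)
  define P where "P = (\<Prod>i<2 * k. f i)"
  define u v where "u = f (2 * k)" and "v = f (Suc (2 * k))"
  have u: "u \<in> two_integral" "(u\<^sup>2 - 1) / 4 \<in> two_integral"
    using odd two_odd_imp_two_integral two_odd_square_cong_one unfolding u_def by auto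
  have v: "v \<in> two_integral" using odd two_odd_imp_two_integral unfolding v_def by auto
  have "(P - 1) / 4 * (u * v) + (u * ((v - u) / 4) + (u\<^sup>2 - 1) / 4) \<in> two_integral"
    using Suc u v cong[of "2 * k"] unfolding P_def u_def v_def
    by (intro two_integral_add two_integral_mult)
  also have "(P - 1) / 4 * (u * v) + (u * ((v - u) / 4) + (u\<^sup>2 - 1) / 4) = (P * u * v - 1) / 4"
    by (simp add: field_simps power2_eq_square)
  also have "P * u * v = (\<Prod>i<2 * Suc k. f i)" by (simp add: P_def u_def v_def)
  finally show ?case .
qed

section \<open>Cycles of a quadratic map\<close>

locale quadratic_cycle =
  fixes c :: rat and x :: "nat \<Rightarrow> rat" and n :: nat
  assumes step: "x (Suc i) = (x i)\<^sup>2 - c"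
    and period: "x (i + n) = x i"
    and distinct: "0 < m \<Longrightarrow> m < n \<Longrightarrow> x (i + m) \<noteq> x i"
begin

lemma period_mult: "x (i + k * n) = x i"
proof (induction k)
  case (Suc k)
  have "x (i + Suc k * n) = x ((i + k * n) + n)" by (simp add: algebra_simps)
  with Suc show ?case by (simp only: period)
qed simp

lemma difference_along_orbit:
  "x (i + k + m) - x (i + k) = (x (i + m) - x i) * (\<Prod>j<k. x (i + j) + x (i + j + m))"
proof (induction k)
  case (Suc k)
  have "x (i + Suc k + m) - x (i + Suc k) =
        (x (i + k + m) - x (i + k)) * (x (i + k) + x (i + k + m))"
    by (simp add: step power2_eq_square algebra_simps)
  then show ?case by (simp add: Suc)
qed simp

lemma prod_sums_eq_one:
  assumes "0 < m" "m < n"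
  shows "(\<Prod>j<n. x (i + j) + x (i + j + m)) = 1"
proof -
  have "x (i + n + m) = x (i + m)" using period[of "i + m"] by (simp add: algebra_simps)
  then have "x (i + m) - x i = (x (i + m) - x i) * (\<Prod>j<n. x (i + j) + x (i + j + m))"
    using difference_along_orbit[of i n m] period[of i] by simp
  with distinct[OF assms, of i] show ?thesis by simp
qed

end

locale small_denominator_cycle = quadratic_cycle +
  assumes length: "n \<ge> 3"
    and small: "8 * c \<in> two_integral"
begin

lemma two_integral_backwards:
  assumes "2 ^ Suc k * x (i + k) \<in> two_integral"
  shows "2 * x i \<in> two_integral"
  using assms
proof (induction k)
  case (Suc k)
  \<comment> \<open>Multiplied by \<open>2^(2 k + 3)\<close>, both \<open>x\<^sub>i\<^sub>+\<^sub>k\<^sub>+\<^sub>1\<close> and \<open>c\<close> are integral, hence so is \<open>x\<^sub>i\<^sub>+\<^sub>k\<^sup>2\<close>.\<close>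
  define y where "y = 2 ^ Suc k * x (i + k)"
  have "2 ^ Suc k * (2 ^ Suc (Suc k) * x (i + Suc k)) + 2 ^ k * (2 ^ k * (8 * c)) \<in> two_integral"
  proof (rule two_integral_add)
    have pow: "2 ^ l \<in> two_integral" for l by (intro two_integral_power) simp
    show "2 ^ Suc k * (2 ^ Suc (Suc k) * x (i + Suc k)) \<in> two_integral"
      using pow Suc.prems by (rule two_integral_mult)
    show "2 ^ k * (2 ^ k * (8 * c)) \<in> two_integral"
      using pow two_integral_mult[OF pow small] by (rule two_integral_mult)
  qed
  also have "2 ^ Suc k * (2 ^ Suc (Suc k) * x (i + Suc k)) + 2 ^ k * (2 ^ k * (8 * c)) = 2 * y\<^sup>2"
    unfolding y_def by (simp add: step power2_eq_square algebra_simps)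
  finally have "y \<in> two_integral" by (rule two_integral_if_double_square)
  then show ?case using Suc.IH unfolding y_def by blast
qed simp

text \<open>
  Each step back along the orbit removes a factor \<open>2\<close> from the denominator, and on a cycle
  one can go back arbitrarily far without leaving the point.
\<close>

lemma double_two_integral: "2 * x i \<in> two_integral"
proof -
  obtain k where k: "2 ^ k * x i \<in> two_integral"
    using ex_power_two_mult_two_integral by blast
  have "k \<le> k * n" using length by simp
  then have "Suc (k * n) - k + k = Suc (k * n)" by (intro le_add_diff_inverse2 le_SucI)
  then have "(2::rat) ^ Suc (k * n) = 2 ^ (Suc (k * n) - k) * 2 ^ k"
    by (simp only: power_add[symmetric])
  then have eq: "2 ^ Suc (k * n) * x i = 2 ^ (Suc (k * n) - k) * (2 ^ k * x i)"
    by (simp only: mult.assoc)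
  have "2 ^ (Suc (k * n) - k) \<in> two_integral" by (intro two_integral_power) simp
  then have "2 ^ Suc (k * n) * x (i + k * n) \<in> two_integral"
    unfolding period_mult eq using k by (rule two_integral_mult)
  then show ?thesis by (rule two_integral_backwards)
qed

lemma add_two_integral: "x i + x j \<in> two_integral"
proof -
  define y where "y = x i + x j"
  \<comment> \<open>Subtracting the two recurrences gives \<open>y\<^sup>2 = 2 x\<^sub>j y + (x\<^sub>i\<^sub>+\<^sub>1 - x\<^sub>j\<^sub>+\<^sub>1)\<close>; doubled, every term is 2-integral.\<close>
  have int_y: "2 * y \<in> two_integral"
    using two_integral_add[OF double_two_integral[of i] double_two_integral[of j]]
    unfolding y_def by (simp add: algebra_simps)
  have "2 * x j * (2 * y) + (2 * x (Suc i) - 2 * x (Suc j)) \<in> two_integral"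
    using two_integral_mult[OF double_two_integral int_y]
      two_integral_diff[OF double_two_integral double_two_integral]
    by (rule two_integral_add)
  also have "2 * x j * (2 * y) + (2 * x (Suc i) - 2 * x (Suc j)) = 2 * y\<^sup>2"
    unfolding y_def by (simp add: step power2_eq_square algebra_simps)
  finally show ?thesis unfolding y_def by (rule two_integral_if_double_square)
qed

text \<open>An even factor would make the product of the 2-integral sums, which is \<open>1\<close>, even.\<close>

lemma add_two_odd:
  assumes "0 < m" "m < n"
  shows "two_odd (x i + x (i + m))"
proof -
  define s where "s j = x (i + j) + x (i + j + m)" for j
  obtain l where l: "n = Suc l" using assms by (cases n) auto
  have "s 0 * (\<Prod>j<l. s (Suc j)) = 1"
    using prod_sums_eq_one[OF assms, of i] unfolding l prod.lessThan_Suc_shift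
    by (simp add: s_def)
  then have eq: "s 0 / 2 * (\<Prod>j<l. s (Suc j)) = 1 / 2" by simp
  have "(\<Prod>j<l. s (Suc j)) \<in> two_integral"
    unfolding s_def by (intro two_integral_prod add_two_integral)
  then have "s 0 / 2 \<in> two_integral \<Longrightarrow> 1 / 2 \<in> two_integral"
    unfolding eq[symmetric] by (intro two_integral_mult)
  then have "s 0 / 2 \<notin> two_integral" using half_not_two_integral by blast
  then show ?thesis
    using two_integral_even_or_odd[OF add_two_integral[of i "i + m"]] by (simp add: s_def)
qed

lemma difference_odd_multiple:
  assumes "0 < m" "m < n"
  obtains u where "two_odd u" "x (i + k + m) - x (i + k) = (x (i + m) - x i) * u"
proof (rule that)
  show "two_odd (\<Prod>j<k. x (i + j) + x (i + j + m))"
    by (intro two_odd_prod add_two_odd[OF assms])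
qed (rule difference_along_orbit)

lemma no_odd_factor:
  assumes n: "n = s * (2 * k + 1)" and "k > 0"
  shows False
proof -
  have "0 < s" using length by (cases s) (simp_all add: n)
  then have s: "0 < s" "s < n" using \<open>k > 0\<close> by (simp_all add: n)
  have "\<exists>u. two_odd u \<and> x (s * Suc j) - x (s * j) = (x s - x 0) * u" for j
    using difference_odd_multiple[OF s, of 0 "s * j"] by (auto simp: algebra_simps)
  then obtain u where u: "two_odd (u j)" "x (s * Suc j) - x (s * j) = (x s - x 0) * u j" for j
    by metis
  have "0 = x (s * (2 * k + 1)) - x (s * 0)"
    using period[of 0] by (simp add: n)
  also have "\<dots> = (\<Sum>j<2 * k + 1. x (s * Suc j) - x (s * j))"
    by (rule sum_lessThan_telescope[symmetric])
  also have "\<dots> = (x s - x 0) * (\<Sum>j<2 * k + 1. u j)"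
    unfolding u(2) sum_distrib_left ..
  finally have "(\<Sum>j<2 * k + 1. u j) = 0"
    using distinct[OF s, of 0] by simp
  moreover have "two_odd (\<Sum>j<2 * k + 1. u j)" using u(1) by (rule two_odd_sum_odd_number)
  ultimately show False using two_odd_not_even[of 0] by simp
qed

text \<open>
  With two further points \<open>y, z\<close> of the cycle, \<open>2 x\<^sub>i = (x\<^sub>i + y) + (x\<^sub>i + z) - (y + z)\<close> is odd, being
  a combination of three odd numbers.
\<close>

lemma double_two_odd: "two_odd (2 * x i)"
proof -
  have n: "(0::nat) < 1" "(0::nat) < 2" "1 < n" "2 < n" using length by linarith+
  have "((x i + x (i + 2)) - (x (i + 1) + x (i + 1 + 1))) / 2 \<in> two_integral"
    by (rule two_odd_diff[OF add_two_odd[OF n(2,4)] add_two_odd[OF n(1,3)]])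
  with add_two_odd[OF n(1) n(3)]
  have "two_odd ((x i + x (i + 1)) + ((x i + x (i + 2)) - (x (i + 1) + x (i + 1 + 1))))"
    by (rule two_odd_add_even)
  then show ?thesis by simp
qed

lemma no_double_even_length:
  assumes n: "n = 2 * m" and "even m"
  shows False
proof -
  obtain k where k: "m = 2 * k" using \<open>even m\<close> by (elim evenE)
  have m: "0 < m" "m < n" and one: "(0::nat) < 1" "1 < n" using length n by auto
  define s where "s i = x i + x (i + m)" for i
  have "x (m + m) = x 0" using period[of 0] by (simp add: n mult_2)
  then have "x 0 - x m = (x m - x 0) * (\<Prod>i<m. s i)"
    using difference_along_orbit[of 0 m m] by (simp add: s_def)
  then have "(x m - x 0) * ((\<Prod>i<m. s i) + 1) = 0" by (simp add: algebra_simps)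
  with distinct[OF m, of 0] have prod: "(\<Prod>i<m. s i) = - 1" by (simp add: add_eq_0_iff2)
  have cong: "(s (Suc i) - s i) / 4 \<in> two_integral" for i
  proof -
    \<comment> \<open>The change \<open>s\<^sub>i\<^sub>+\<^sub>1 - s\<^sub>i\<close> equals \<open>d + d u\<close> with \<open>d\<close> even and \<open>u\<close> odd.\<close>
    define d where "d = x (Suc i) - x i"
    obtain u where u: "two_odd u" "x (i + m + 1) - x (i + m) = (x (i + 1) - x i) * u"
      by (rule difference_odd_multiple[OF one])
    have "d = (x i + x (i + 1)) - 2 * x i" by (simp add: d_def)
    then have "d / 2 \<in> two_integral"
      using two_odd_diff[OF add_two_odd[OF one] double_two_odd, of i i] by simp
    moreover have "(1 + u) / 2 \<in> two_integral" using u by (intro two_odd_add) auto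
    ultimately have "d / 2 * ((1 + u) / 2) \<in> two_integral" by (rule two_integral_mult)
    moreover have "s (Suc i) - s i = d * (1 + u)"
      using u(2) by (simp add: s_def d_def algebra_simps)
    ultimately show ?thesis by simp
  qed
  have odd: "two_odd (s i)" for i using add_two_odd[OF m] by (simp add: s_def)
  have "((\<Prod>i<2 * k. s i) - 1) / 4 \<in> two_integral"
    using odd cong by (rule prod_even_number_cong_one)
  then have "(- 1 / 2 :: rat) \<in> two_integral" using prod unfolding k by simp
  then show False using two_integral_minus[of "- 1 / 2"] half_not_two_integral by simp
qed

lemma contradiction: False
proof (cases "odd n")
  case True
  then obtain k where "n = 1 * (2 * k + 1)" by (auto elim!: oddE)
  then show False using no_odd_factor[of 1 k] length by simp
next
  case False
  then obtain m where n: "n = 2 * m" by (auto elim!: evenE)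
  show False
  proof (cases "even m")
    case True
    with n show False by (rule no_double_even_length)
  next
    case False
    then obtain k where "m = 2 * k + 1" by (auto elim!: oddE)
    then show False using no_odd_factor[of 2 k] n length by simp
  qed
qed

end

section \<open>Divisibility of the denominator\<close>

lemma quadratic_cycle_of_exact_period:
  assumes "periodic (phi c) z" and n: "least_power (phi c) z = n"
  shows "quadratic_cycle c (\<lambda>i. (phi c ^^ i) z) n"
proof
  obtain k where k: "k > 0" "(phi c ^^ k) z = z"
    using assms(1) unfolding periodic_def by (auto simp: Suc_le_eq)
  have per: "(phi c ^^ n) z = z" and "n > 0"
    using least_powerI[OF k(2,1)] n by auto
  fix i
  show "(phi c ^^ Suc i) z = ((phi c ^^ i) z)\<^sup>2 - c" by (simp add: phi_def)
  show period: "(phi c ^^ (i + n)) z = (phi c ^^ i) z" for i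
    by (simp add: funpow_add per)
  fix m assume m: "0 < m" "m < n"
  show "(phi c ^^ (i + m)) z \<noteq> (phi c ^^ i) z"
  proof
    assume eq: "(phi c ^^ (i + m)) z = (phi c ^^ i) z"
    \<comment> \<open>Continuing the orbit from \<open>x\<^sub>i\<close> to \<open>x\<^bsub>in\<^esub> = z\<close> moves the coincidence to \<open>z\<close> itself.\<close>
    have multiple: "(phi c ^^ (q * n)) z = z" for q
      by (induction q) (simp_all add: funpow_add per)
    define r where "r = i * n - i"
    have r: "r + i = i * n" using \<open>n > 0\<close> by (simp add: r_def)
    have "(phi c ^^ (r + (i + m))) z = (phi c ^^ (r + i)) z"
      using eq by (simp only: funpow_add comp_apply)
    moreover have "r + (i + m) = m + i * n" using r by simp
    ultimately have "(phi c ^^ m) z = z" using r multiple by (simp add: funpow_add)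
    then have "n \<le> m" using least_power_le[of m "phi c" z] m n by simp
    with m show False by simp
  qed
qed

theorem theorem2p12:
  fixes c :: rat and n :: nat
  assumes "n \<ge> 3"
    and "\<exists>zs. is_cycle (phi c) n zs"
  shows "16 dvd den c"
proof (rule ccontr)
  assume "\<not> 16 dvd den c"
  obtain z where z: "periodic (phi c) z" "least_power (phi c) z = n"
    using assms(2) unfolding is_cycle_def by blast
  interpret quadratic_cycle c "\<lambda>i. (phi c ^^ i) z" n
    using z by (rule quadratic_cycle_of_exact_period)
  interpret small_denominator_cycle c "\<lambda>i. (phi c ^^ i) z" n
    using assms(1) eight_mult_two_integral[OF \<open>\<not> 16 dvd den c\<close>] by unfold_locales
  show False by (rule contradiction)
qed

end
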